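(* Let $D, n_x,n_\phi\in\mathbb{N}$, let $\phi:\mathbb{R}^{n_x}\to\mathbb{R}^{n_\phi}$, let $\sigma_W^2>0$, and let $k(x,x')=\sigma_W^2\,\phi(x)^\top\phi(x')$. Let $(x_i,y_i)\in\mathbb{R}^{n_x}\times\mathbb{R}$, $i\in\{1,\dots,D\}$, be given (deterministic) data, and let $\rho^2>0$. Suppose that the i.i.d. noise random variables $M_i\in\mathcal{L}^2(\Omega,\mathcal{F},\mathbb{P};\mathbb{R})$, $i\in\{1,\dots,D\}$, have an exact polynomial chaos expansion (PCE) of dimension $L=2$, i.e. $M_i=\mathsf{m}^0+\mathsf{m}^1\varphi^1(\xi_i)$ with $\mathsf{m}^0,\mathsf{m}^1\in\mathbb{R}$. For $x\in\mathbb{R}^{n_x}$ let $\widehat{Y}(x)$ be the Wiener kernel prediction $$\widehat{Y}(x)=\mathbf{k}(x)^\top(\mathbf{K}+\rho^2\mathbf{I})^{-1}\Big[\mathbf{y}^0+\sum_{j=1}^D\mathbf{y}^j\varphi^1(\xi_j)\Big],\qquad \mathbf{y}^0=\mathbf{y}-\mathsf{m}^0\mathbf{1}_D,\quad \mathbf{y}^j=-e_j\mathsf{m}^1\ (j\ge1).$$ Then for every $x\in\mathbb{R}^{n_x}$: i) $$\mathbb{E}\big[\widehat{Y}(x)\big]=\mathbf{k}(x)^\top(\mathbf{K}+\rho^2\mathbf{I})^{-1}\mathbf{y}^0,\qquad \mathbf{y}^0=\mathbf{y}-\mathsf{m}^0\mathbf{1}_D.$$ ii) Specifically, if $M_i\sim\mathcal{N}(0,\sigma_M^2)$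 with $\sigma_M^2>0$, then the choice $\rho^2=\sigma_M^2$ implies that the Gaussian process posterior mean prediction $\mu(x)=\mathbf{k}(x)^\top(\mathbf{K}+\sigma_M^2\mathbf{I})^{-1}\mathbf{y}$ equals $\mathbb{E}[\widehat{Y}(x)]$. iii) Moreover, for any i.i.d. $M_i\in\mathcal{L}^2(\Omega,\mathcal{F},\mathbb{P};\mathbb{R})$, $i\in\{1,\dots,D\}$, having an exact PCE of dimension $L=2$, $M_i=\mathsf{m}^0+\mathsf{m}^1\varphi^1(\xi_i)$ with $\mathsf{m}^0,\mathsf{m}^1\in\mathbb{R}$ (not necessarily Gaussian), $$\mathbb{V}\big[\widehat{Y}(x)\big]=\sigma_M^2\,\mathbf{k}(x)^\top(\mathbf{K}+\rho^2\mathbf{I})^{-2}\mathbf{k}(x),\qquad \sigma_M^2=(\mathsf{m}^1)^2.$$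
   Context: $(\Omega,\mathcal{F},\mathbb{P})$ is a probability space, $\mathcal{L}^2(\Omega,\mathcal{F},\mathbb{P};\mathbb{R})$ is the Hilbert space of real random variables with finite second moment, and $\mathbb{E}$, $\mathbb{V}$ denote expectation and variance. Notation: $\mathbf{k}(x)=[k(x_1,x)\ \dots\ k(x_D,x)]^\top\in\mathbb{R}^D$, $\mathbf{K}\in\mathbb{R}^{D\times D}$ is the Gram matrix with $\mathbf{K}_{ij}=k(x_i,x_j)$, $\mathbf{I}$ is the identity matrix, $\mathbf{y}=[y_1\ \dots\ y_D]^\top$, $\mathbf{1}_D=[1\ \dots\ 1]^\top\in\mathbb{R}^D$, and $e_j$ is the $j$-th Euclidean basis vector of $\mathbb{R}^D$. PCE setting: $\xi_1,\dots,\xi_D$ are i.i.d. real random variables in $\mathcal{L}^2(\Omega,\mathcal{F},\mathbb{P};\mathbb{R})$, and $\varphi^0=1,\varphi^1,\dots$ are polynomials that are orthonormal in the sense $\mathbb{E}[\varphi^a(\xi_i)\varphi^b(\xi_i)]=\delta^{ab}$. In particular $\mathbb{E}[\varphi^1(\xi_i)]=0$ and $\mathbb{E}[\varphi^1(\xi_i)^2]=1$ for all $i$, and $\varphi^1(\xi_1),\dots,\varphi^1(\xi_D)$ are independent. A random variable $V$ has an exact PCE of dimension $L$ if $V=\sum_{j=0}^{L-1}\mathsf{v}^j\varphi^j(\xi)$ for real coefficients $\mathsf{v}^j$. The data $y_i$ are treated as fixed real numbers when taking $\mathbb{E}$ and $\mathbb{V}$ of $\widehat{Y}(x)$. *)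

theory Defs
  imports "HOL-Probability.Probability"
begin

definition square_integrable_rv :: "'a measure \<Rightarrow> ('a \<Rightarrow> real) \<Rightarrow> bool" where
  "square_integrable_rv P V \<longleftrightarrow>
     V \<in> borel_measurable P \<and> integrable P (\<lambda>\<omega>. (V \<omega>)\<^sup>2)"

definition iid_rvs :: "'a measure \<Rightarrow> ('d \<Rightarrow> 'a \<Rightarrow> real) \<Rightarrow> bool" where
  "iid_rvs P V \<longleftrightarrow>
     prob_space.indep_vars P (\<lambda>_. borel) V UNIV \<and>
     (\<forall>i j. distr P borel (V i) = distr P borel (V j))"

(* The Bochner integral of a non-integrable function is 0, but the case a = b
   forces every poly (\<phi> a) \<circ> V to be square integrable (V measurable), so
   all the products are integrable. *)
definition orthonormal_polys :: "'a measure \<Rightarrow> ('a \<Rightarrow> real) \<Rightarrow> (nat \<Rightarrow> real poly) \<Rightarrow> bool" where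
  "orthonormal_polys P V \<phi> \<longleftrightarrow>
     (\<forall>a b. prob_space.expectation P (\<lambda>\<omega>. poly (\<phi> a) (V \<omega>) * poly (\<phi> b) (V \<omega>))
              = (if a = b then 1 else 0))"

(* Equality in L^2, i.e. almost surely. *)
definition exact_pce ::
  "'a measure \<Rightarrow> (nat \<Rightarrow> real poly) \<Rightarrow> ('a \<Rightarrow> real) \<Rightarrow> nat \<Rightarrow> (nat \<Rightarrow> real) \<Rightarrow> ('a \<Rightarrow> real) \<Rightarrow> bool"
where
  "exact_pce P \<phi> \<xi> L v V \<longleftrightarrow> (AE \<omega> in P. V \<omega> = (\<Sum>j<L. v j * poly (\<phi> j) (\<xi> \<omega>)))"

definition feature_kernel ::
  "real \<Rightarrow> (real ^ 'n \<Rightarrow> real ^ 'p) \<Rightarrow> real ^ 'n \<Rightarrow> real ^ 'n \<Rightarrow> real" where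
  "feature_kernel \<sigma>\<^sub>W f x x' = \<sigma>\<^sub>W\<^sup>2 * (f x \<bullet> f x')"

definition kernel_vec :: "('x \<Rightarrow> 'x \<Rightarrow> real) \<Rightarrow> ('d \<Rightarrow> 'x) \<Rightarrow> 'x \<Rightarrow> real ^ 'd" where
  "kernel_vec k X x = (\<chi> i. k (X i) x)"

definition gram_matrix :: "('x \<Rightarrow> 'x \<Rightarrow> real) \<Rightarrow> ('d \<Rightarrow> 'x) \<Rightarrow> real ^ 'd ^ 'd" where
  "gram_matrix k X = (\<chi> i j. k (X i) (X j))"

(* (K + r I)^{-1}; invertible whenever r > 0 and K is positive semidefinite. *)
definition reg_gram_inv :: "('x \<Rightarrow> 'x \<Rightarrow> real) \<Rightarrow> ('d \<Rightarrow> 'x) \<Rightarrow> real \<Rightarrow> real ^ 'd ^ 'd" where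
  "reg_gram_inv k X r = matrix_inv (gram_matrix k X + r *\<^sub>R mat 1)"

definition data_coeff0 :: "real ^ 'd \<Rightarrow> (nat \<Rightarrow> real) \<Rightarrow> real ^ 'd" where
  "data_coeff0 y m = y - m 0 *\<^sub>R (\<chi> i. 1)"

definition data_coeff :: "(nat \<Rightarrow> real) \<Rightarrow> 'd \<Rightarrow> real ^ 'd" where
  "data_coeff m j = - (m 1 *\<^sub>R axis j 1)"

definition wiener_prediction ::
  "('x \<Rightarrow> 'x \<Rightarrow> real) \<Rightarrow> ('d \<Rightarrow> 'x) \<Rightarrow> real ^ 'd \<Rightarrow> real \<Rightarrow> (nat \<Rightarrow> real) \<Rightarrow>
   (nat \<Rightarrow> real poly) \<Rightarrow> ('d \<Rightarrow> 'a \<Rightarrow> real) \<Rightarrow> 'x \<Rightarrow> 'a \<Rightarrow> real"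
where
  "wiener_prediction k X y r m \<phi> \<xi> x \<omega> =
     kernel_vec k X x \<bullet> (reg_gram_inv k X r *v
       (data_coeff0 y m + (\<Sum>j\<in>UNIV. poly (\<phi> 1) (\<xi> j \<omega>) *\<^sub>R data_coeff m j)))"

definition gp_posterior_mean ::
  "('x \<Rightarrow> 'x \<Rightarrow> real) \<Rightarrow> ('d \<Rightarrow> 'x) \<Rightarrow> real ^ 'd \<Rightarrow> real \<Rightarrow> 'x \<Rightarrow> real" where
  "gp_posterior_mean k X y s x = kernel_vec k X x \<bullet> (reg_gram_inv k X s *v y)"

end

theory Submission
  imports Defs
begin

text \<open>
  The prediction is the constant \<open>k(x)\<^sup>T (K + \<rho>\<^sup>2 I)\<inverse> y\<^sup>0\<close> plus a linear combination of the centred,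
  orthonormal variables \<open>\<phi>\<^sup>1(\<xi>\<^sub>j)\<close>, so its mean is the constant and its variance is the sum of the
  squared coefficients, \<open>(m\<^sup>1)\<^sup>2\<close> times the squared norm of \<open>k(x)\<^sup>T (K + \<rho>\<^sup>2 I)\<inverse>\<close>. This norm is the
  quadratic form of \<open>(K + \<rho>\<^sup>2 I)\<^sup>-\<^sup>2\<close> because \<open>K\<close> is symmetric and, \<open>K\<close> being positive semidefinite,
  \<open>K + \<rho>\<^sup>2 I\<close> is invertible. Gaussian noise of mean zero forces \<open>m\<^sup>0 = 0\<close>, whence part (ii).
\<close>

lemma matrix_inv_mult:
  fixes A :: "'a::semiring_1 ^ 'n ^ 'm"
  assumes "invertible A"
  shows "matrix_inv A ** A = mat 1" and "A ** matrix_inv A = mat 1"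
  using someI_ex[OF assms[unfolded invertible_def]] by (auto simp: matrix_inv_def)

text \<open>Transposing \<open>A ** matrix_inv A = mat 1\<close> makes the transposed inverse a left
  inverse of \<open>A\<close>, and a left inverse coincides with the right inverse.\<close>

lemma transpose_matrix_inv_symmetric:
  fixes A :: "'a::comm_ring_1 ^ 'n ^ 'n"
  assumes "invertible A" and "transpose A = A"
  shows "transpose (matrix_inv A) = matrix_inv A"
proof -
  let ?B = "matrix_inv A"
  have "transpose ?B ** A = mat 1"
    using arg_cong[OF matrix_inv_mult(2)[OF assms(1)], of transpose]
    by (simp add: matrix_transpose_mul assms(2))
  then have "transpose ?B ** (A ** ?B) = ?B"
    by (simp add: matrix_mul_assoc)
  then show ?thesis
    by (simp add: matrix_inv_mult(2)[OF assms(1)])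
qed

text \<open>Pairing a kernel vector \<open>v\<close> with its own image bounds
  \<open>r * (v \<bullet> v)\<close> by 0, so the kernel is trivial; for a square matrix this gives
  invertibility.\<close>

lemma invertible_psd_add_scaled_mat:
  fixes K :: "real ^ 'n ^ 'n"
  assumes psd: "\<And>v. 0 \<le> v \<bullet> (K *v v)" and r: "r > 0"
  shows "invertible (K + r *\<^sub>R mat 1)"
proof -
  have "v = 0" if "(K + r *\<^sub>R mat 1) *v v = 0" for v
  proof -
    have "v \<bullet> (K *v v) + r * (v \<bullet> v) = v \<bullet> ((K + r *\<^sub>R mat 1) *v v)"
      by (simp add: matrix_vector_mult_add_rdistrib inner_add_right scaleR_matrix_vector_assoc[symmetric])
    also have "\<dots> = 0"
      using that by simp
    finally have "r * (v \<bullet> v) \<le> 0"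
      using psd[of v] by linarith
    then show "v = 0"
      using r by (metis inner_eq_zero_iff inner_ge_zero linorder_not_less mult_pos_pos order_less_le)
  qed
  then show ?thesis
    unfolding invertible_left_inverse matrix_left_invertible_ker by blast
qed

text \<open>The quadratic form is \<open>s\<^sup>2\<close> times the squared norm of the feature
  vectors combined with weights \<open>v\<close>.\<close>

lemma gram_matrix_feature_kernel_psd:
  fixes X :: "'d::finite \<Rightarrow> real ^ 'n"
  shows "0 \<le> v \<bullet> (gram_matrix (feature_kernel s f) X *v v)"
proof -
  let ?w = "\<Sum>i\<in>UNIV. v $ i *\<^sub>R f (X i)"
  have "v \<bullet> (gram_matrix (feature_kernel s f) X *v v) = s\<^sup>2 * (?w \<bullet> ?w)"
    by (simp add: inner_vec_def[of v] gram_matrix_def feature_kernel_def matrix_vector_mult_def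
        inner_sum_left inner_sum_right sum_distrib_left mult_ac inner_commute)
  then show ?thesis
    by simp
qed

text \<open>Invertibility is settled first, because \<open>matrix_inv\<close> of a singular matrix
  is an unspecified choice.\<close>

lemma transpose_reg_gram_inv_feature_kernel:
  fixes X :: "'d::finite \<Rightarrow> real ^ 'n"
  assumes "r > 0"
  shows "transpose (reg_gram_inv (feature_kernel s f) X r) = reg_gram_inv (feature_kernel s f) X r"
  unfolding reg_gram_inv_def
proof (rule transpose_matrix_inv_symmetric)
  let ?K = "gram_matrix (feature_kernel s f) X"
  show "invertible (?K + r *\<^sub>R mat 1)"
    using gram_matrix_feature_kernel_psd assms by (rule invertible_psd_add_scaled_mat)
  have "?K $ i $ j = ?K $ j $ i" for i j
    by (simp add: gram_matrix_def feature_kernel_def inner_commute)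
  then show "transpose (?K + r *\<^sub>R mat 1) = ?K + r *\<^sub>R mat 1"
    by (simp add: transpose_def mat_def vec_eq_iff)
qed

lemma (in prob_space) affine_combination_orthonormal:
  fixes Z :: "'d::finite \<Rightarrow> 'a \<Rightarrow> real"
  assumes [simp]: "\<And>i. integrable M (Z i)" "\<And>i j. integrable M (\<lambda>\<omega>. Z i \<omega> * Z j \<omega>)"
    and mean: "\<And>i. expectation (Z i) = 0"
    and orth: "\<And>i j. expectation (\<lambda>\<omega>. Z i \<omega> * Z j \<omega>) = (if i = j then 1 else 0)"
  shows "expectation (\<lambda>\<omega>. c + (\<Sum>j\<in>UNIV. d j * Z j \<omega>)) = c" (is ?mean)
    and "variance (\<lambda>\<omega>. c + (\<Sum>j\<in>UNIV. d j * Z j \<omega>)) = (\<Sum>j\<in>UNIV. (d j)\<^sup>2)"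
proof -
  show ?mean
    by (simp add: mean prob_space)
  then have "variance (\<lambda>\<omega>. c + (\<Sum>j\<in>UNIV. d j * Z j \<omega>))
      = expectation (\<lambda>\<omega>. \<Sum>i\<in>UNIV. \<Sum>j\<in>UNIV. d i * d j * (Z i \<omega> * Z j \<omega>))"
    by (simp add: power2_eq_square sum_product mult_ac)
  also have "\<dots> = (\<Sum>i\<in>UNIV. \<Sum>j\<in>UNIV. d i * d j * (if i = j then 1 else 0))"
    by (simp add: orth)
  also have "\<dots> = (\<Sum>j\<in>UNIV. (d j)\<^sup>2)"
    by (simp add: power2_eq_square if_distrib cong: if_cong)
  finally show "variance (\<lambda>\<omega>. c + (\<Sum>j\<in>UNIV. d j * Z j \<omega>)) = (\<Sum>j\<in>UNIV. (d j)\<^sup>2)" .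
qed

lemma borel_measurable_poly [measurable (raw)]:
  fixes V :: "'a \<Rightarrow> real"
  assumes "V \<in> borel_measurable N"
  shows "(\<lambda>\<omega>. poly p (V \<omega>)) \<in> borel_measurable N"
  by (rule borel_measurable_continuous_on[OF _ assms]) (intro continuous_intros)

text \<open>The Bochner integral of a non-integrable function is 0. Hence the normalisation of the
  polynomials already certifies their square integrability.\<close>

lemma integrable_if_integral_eq_1:
  fixes g :: "'a \<Rightarrow> real"
  assumes "integral\<^sup>L N g = 1"
  shows "integrable N g"
  using assms not_integrable_integral_eq[of N g] by fastforce

lemma (in prob_space) integrable_orthonormal_poly:
  assumes "V \<in> borel_measurable M" and "orthonormal_polys M V \<phi>"
  shows "integrable M (\<lambda>\<omega>. poly (\<phi> a) (V \<omega>))"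
proof (rule square_integrable_imp_integrable)
  have "expectation (\<lambda>\<omega>. poly (\<phi> a) (V \<omega>) * poly (\<phi> a) (V \<omega>)) = 1"
    using assms(2) by (simp add: orthonormal_polys_def)
  then show "integrable M (\<lambda>\<omega>. (poly (\<phi> a) (V \<omega>))\<^sup>2)"
    by (simp add: power2_eq_square integrable_if_integral_eq_1)
qed (use assms(1) in measurable)

text \<open>Orthogonality to the constant polynomial is centredness.\<close>

lemma (in prob_space) expectation_orthonormal_poly_1:
  assumes "orthonormal_polys M V \<phi>" and "\<phi> 0 = 1"
  shows "expectation (\<lambda>\<omega>. poly (\<phi> 1) (V \<omega>)) = 0"
proof -
  have "expectation (\<lambda>\<omega>. poly (\<phi> 1) (V \<omega>) * poly (\<phi> 0) (V \<omega>)) = 0"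
    using assms(1) by (simp add: orthonormal_polys_def)
  then show ?thesis
    by (simp add: assms(2))
qed

text \<open>Orthonormality of the polynomials speaks of one \<open>\<xi> i\<close> at a time and
  covers \<open>i = j\<close>. For distinct indices, independence factorises the mixed moment into
  means, which vanish.\<close>

lemma (in prob_space) indep_orthonormal_poly:
  fixes \<xi> :: "'d \<Rightarrow> 'a \<Rightarrow> real"
  assumes ind: "indep_vars (\<lambda>_. borel) \<xi> UNIV"
    and on: "\<And>i. orthonormal_polys M (\<xi> i) \<phi>" and phi0: "\<phi> 0 = 1"
  shows "integrable M (\<lambda>\<omega>. poly (\<phi> 1) (\<xi> i \<omega>) * poly (\<phi> 1) (\<xi> j \<omega>))" (is ?int)
    and "expectation (\<lambda>\<omega>. poly (\<phi> 1) (\<xi> i \<omega>) * poly (\<phi> 1) (\<xi> j \<omega>)) = (if i = j then 1 else 0)" (is ?exp)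
proof -
  have "?int \<and> ?exp"
  proof (cases "i = j")
    case True
    have "expectation (\<lambda>\<omega>. poly (\<phi> 1) (\<xi> i \<omega>) * poly (\<phi> 1) (\<xi> i \<omega>)) = 1"
      using on by (simp add: orthonormal_polys_def)
    then show ?thesis
      using True by (simp add: integrable_if_integral_eq_1)
  next
    case False
    define Z where "Z l \<omega> = poly (\<phi> 1) (\<xi> l \<omega>)" for l \<omega>
    have meas: "\<xi> l \<in> borel_measurable M" for l
      using ind by (simp add: indep_vars_def)
    have Z: "integrable M (Z l)" "expectation (Z l) = 0" for l
      using integrable_orthonormal_poly[OF meas on] expectation_orthonormal_poly_1[OF on phi0]
      by (simp_all add: Z_def[abs_def])
    have "indep_vars (\<lambda>_. borel) Z UNIV"
      unfolding Z_def[abs_def] by (rule indep_vars_compose2[OF ind]) measurable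
    then have indZ: "indep_vars (\<lambda>_. borel) Z {i, j}"
      by (rule indep_vars_subset) simp
    \<comment> \<open>Since \<open>i\<close> and \<open>j\<close> differ, the product over
      \<open>{i, j}\<close> is the product of the two variables.\<close>
    have "integrable M (\<lambda>\<omega>. \<Prod>l\<in>{i, j}. Z l \<omega>)"
      by (rule indep_vars_integrable[OF _ indZ]) (simp_all add: Z)
    moreover have "expectation (\<lambda>\<omega>. \<Prod>l\<in>{i, j}. Z l \<omega>) = (\<Prod>l\<in>{i, j}. expectation (Z l))"
      by (rule indep_vars_lebesgue_integral[OF _ indZ]) (simp_all add: Z)
    ultimately show ?thesis
      using False Z by (simp add: Z_def)
  qed
  then show ?int ?exp by blast+
qed

text \<open>Each \<open>data_coeff m j\<close> is a multiple of a basis vector, so it picks out one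
  entry of the row vector \<open>kernel_vec k X x v* reg_gram_inv k X r\<close>.\<close>

lemma wiener_prediction_eq:
  "wiener_prediction k X y r m \<phi> \<xi> x \<omega> =
     kernel_vec k X x \<bullet> (reg_gram_inv k X r *v data_coeff0 y m)
     + (\<Sum>j\<in>UNIV. - m 1 * (kernel_vec k X x v* reg_gram_inv k X r) $ j * poly (\<phi> 1) (\<xi> j \<omega>))"
  by (simp add: wiener_prediction_def data_coeff_def dot_lmul_matrix[symmetric] inner_add_right
      inner_sum_right inner_axis mult_ac)

lemma (in prob_space) expectation_exact_pce_2:
  assumes "\<xi> \<in> borel_measurable M" and "orthonormal_polys M \<xi> \<phi>" and "\<phi> 0 = 1"
    and "V \<in> borel_measurable M" and "exact_pce M \<phi> \<xi> 2 m V"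
  shows "expectation V = m 0"
proof -
  note [measurable] = assms(1,4)
  have "AE \<omega> in M. V \<omega> = m 0 + m 1 * poly (\<phi> 1) (\<xi> \<omega>)"
    using assms(5) by (simp add: exact_pce_def numeral_2_eq_2 assms(3))
  then have "expectation V = expectation (\<lambda>\<omega>. m 0 + m 1 * poly (\<phi> 1) (\<xi> \<omega>))"
    by (intro integral_cong_AE) measurable
  also have "\<dots> = m 0"
    using integrable_orthonormal_poly[OF assms(1,2)] expectation_orthonormal_poly_1[OF assms(2,3)]
    by (simp add: prob_space)
  finally show ?thesis .
qed

theorem lemma2:
  fixes P :: "'a measure"
    and f :: "real ^ 'n \<Rightarrow> real ^ 'p"
    and X :: "'d::finite \<Rightarrow> real ^ 'n"
    and y :: "real ^ 'd"
    and \<sigma>\<^sub>W \<rho> :: real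
    and \<xi> M :: "'d \<Rightarrow> 'a \<Rightarrow> real"
    and \<phi> :: "nat \<Rightarrow> real poly"
    and m :: "nat \<Rightarrow> real"
    and x :: "real ^ 'n"
  defines "k \<equiv> feature_kernel \<sigma>\<^sub>W f"
  defines "Y \<equiv> wiener_prediction k X y (\<rho>\<^sup>2) m \<phi> \<xi>"
  assumes "prob_space P"
    and "\<sigma>\<^sub>W\<^sup>2 > 0"
    and "\<rho>\<^sup>2 > 0"
    and "iid_rvs P \<xi>"
    and "\<And>i. square_integrable_rv P (\<xi> i)"
    and "\<phi> 0 = 1"
    and "\<And>i. orthonormal_polys P (\<xi> i) \<phi>"
    and "iid_rvs P M"
    and "\<And>i. square_integrable_rv P (M i)"
    and "\<And>i. exact_pce P \<phi> (\<xi> i) 2 m (M i)"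
  shows "prob_space.expectation P (Y x)
           = kernel_vec k X x \<bullet> (reg_gram_inv k X (\<rho>\<^sup>2) *v data_coeff0 y m)
    \<and> (\<forall>\<sigma>\<^sub>M::real. \<sigma>\<^sub>M\<^sup>2 > 0 \<longrightarrow>
           (\<forall>i. distributed P lborel (M i) (normal_density 0 \<sigma>\<^sub>M)) \<longrightarrow>
           \<rho>\<^sup>2 = \<sigma>\<^sub>M\<^sup>2 \<longrightarrow>
           gp_posterior_mean k X y (\<sigma>\<^sub>M\<^sup>2) x = prob_space.expectation P (Y x))
    \<and> prob_space.variance P (Y x)
           = (m 1)\<^sup>2 * (kernel_vec k X x \<bullet>
               ((reg_gram_inv k X (\<rho>\<^sup>2) ** reg_gram_inv k X (\<rho>\<^sup>2)) *v kernel_vec k X x))"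
proof -
  interpret prob_space P by fact
  let ?G = "reg_gram_inv k X (\<rho>\<^sup>2)" and ?\<kappa> = "kernel_vec k X x"
  let ?c = "?\<kappa> \<bullet> (?G *v data_coeff0 y m)"
  define d where "d j = - m 1 * (?\<kappa> v* ?G) $ j" for j
  define Z where "Z j \<omega> = poly (\<phi> 1) (\<xi> j \<omega>)" for j \<omega>
  note [measurable] = assms(7,11)[unfolded square_integrable_rv_def, THEN conjunct1]
  have ind: "indep_vars (\<lambda>_. borel) \<xi> UNIV"
    using assms(6) by (simp add: iid_rvs_def)
  have Y: "Y x = (\<lambda>\<omega>. ?c + (\<Sum>j\<in>UNIV. d j * Z j \<omega>))"
    by (simp add: Y_def d_def Z_def wiener_prediction_eq fun_eq_iff)
  have Z: "integrable P (Z i)" "integrable P (\<lambda>\<omega>. Z i \<omega> * Z j \<omega>)" "expectation (Z i) = 0"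
    "expectation (\<lambda>\<omega>. Z i \<omega> * Z j \<omega>) = (if i = j then 1 else 0)" for i j
    unfolding Z_def[abs_def]
    by (intro integrable_orthonormal_poly[OF _ assms(9)] expectation_orthonormal_poly_1[OF assms(9,8)]
        indep_orthonormal_poly[OF ind assms(9,8)]; measurable)+
  have mean: "expectation (Y x) = ?c"
    unfolding Y by (rule affine_combination_orthonormal(1)[OF Z])
  have G: "transpose ?G = ?G"
    unfolding k_def by (rule transpose_reg_gram_inv_feature_kernel) fact
  have "variance (Y x) = (\<Sum>j\<in>UNIV. (d j)\<^sup>2)"
    unfolding Y by (rule affine_combination_orthonormal(2)[OF Z])
  also have "\<dots> = (m 1)\<^sup>2 * ((?\<kappa> v* ?G) \<bullet> (?\<kappa> v* ?G))"
    by (simp add: d_def inner_vec_def sum_distrib_left power2_eq_square mult_ac)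
  \<comment> \<open>Symmetry identifies \<open>?\<kappa> v* ?G\<close> with
    \<open>?G *v ?\<kappa>\<close> in the second factor; the matrix in the first factor moves across
    the inner product.\<close>
  also have "(?\<kappa> v* ?G) \<bullet> (?\<kappa> v* ?G) = ?\<kappa> \<bullet> (?G *v (?G *v ?\<kappa>))"
    using transpose_matrix_vector[of ?G ?\<kappa>] by (simp only: G dot_lmul_matrix)
  finally have var: "variance (Y x) = (m 1)\<^sup>2 * (?\<kappa> \<bullet> ((?G ** ?G) *v ?\<kappa>))"
    by (simp add: matrix_vector_mul_assoc)
  have gp: "gp_posterior_mean k X y (\<sigma>\<^sub>M\<^sup>2) x = expectation (Y x)"
    if "\<sigma>\<^sub>M\<^sup>2 > 0" "\<forall>i. distributed P lborel (M i) (normal_density 0 \<sigma>\<^sub>M)" "\<rho>\<^sup>2 = \<sigma>\<^sub>M\<^sup>2"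
    for \<sigma>\<^sub>M :: real
  proof -
    \<comment> \<open>Any index will do: the type of indices is inhabited, and all the noise
      variables share the coefficients \<open>m\<close>.\<close>
    fix i
    \<comment> \<open>\<open>\<sigma>\<^sub>M\<close> may be negative, but the density depends only on \<open>\<sigma>\<^sub>M\<^sup>2\<close>.\<close>
    have "normal_density 0 \<sigma>\<^sub>M = normal_density 0 \<bar>\<sigma>\<^sub>M\<bar>"
      by (simp add: normal_density_def fun_eq_iff)
    then have "expectation (M i) = 0"
      using that by (intro normal_distributed_expectation[of "\<bar>\<sigma>\<^sub>M\<bar>"]) auto
    then have "m 0 = 0"
      using expectation_exact_pce_2[OF _ assms(9,8) _ assms(12), of i] by simp
    then show ?thesis
      by (simp add: mean gp_posterior_mean_def that(3) data_coeff0_def)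
  qed
  show ?thesis
    by (intro conjI allI impI mean var) (rule gp; assumption)
qed

end
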